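(* Let $n\ge1$, $\alpha\in[0,1]$, $\theta\in\Omega$, $u_i=e^{\theta^i}$ and $s:=\sum_{i=1}^nu_i$. Then $$M_\alpha(\theta):=e^{\Psi_\alpha(\theta)}=(1+s)^\alpha(1-s)^{\alpha-1}=(1+s)\,(1-s^2)^{\alpha-1}.$$ Consequently, writing $N:=\sum_ix_i$ and $m:=\lfloor N/2\rfloor$ for $x=(x_1,\dots,x_n)\in\mathbb Z_{\ge0}^n$, the base (counting) measure $h$ on $\mathbb Z_{\ge0}^n$ of the exponential family with partition function $M_\alpha$, i.e. the weights with $M_\alpha(\theta)=\sum_{x}h(x)e^{\theta\cdot x}$, is $$h(x_1,\dots,x_n)=\binom{m-\alpha}{m}\binom{N}{x_1,\dots,x_n}.$$ Equivalently, the probability mass function $p_\theta(x)=h(x)e^{\theta\cdot x}/M_\alpha(\theta)$ is exactly that of the random vector $(X_1,\dots,X_n)$ constructed as follows: (i) draw $M\in\mathbb Z_{\ge0}$ from the law $P(M=m)\propto\binom{m-\alpha}{m}s^{2m}$ (a negative-binomial-type law with parameter $r=1-\alpha$); (ii) draw $B\in\{0,1\}$ independently of $M$ from $\operatorname{Bernoulli}\big(\tfrac{s}{1+s}\big)$, i.e. $P(B=1)=\tfrac{s}{1+s}$, $P(B=0)=\tfrac1{1+s}$, and set $N=2M+B$; (iii) draw $(X_1,\dots,X_n)\mid N\sim\operatorname{Multinomial}(N;p_1,\dots,p_n)$ with $p_i=u_i/s$.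
   Context: $\Omega:=\{\theta\in\mathbb R^n:\sum_ie^{\theta^i}<1\}$, $\Psi_+(\theta):=\log(1+\sum_iu_i)$, $\Psi_-(\theta):=-\log(1-\sum_iu_i)$, $\Psi_\alpha:=\alpha\Psi_++(1-\alpha)\Psi_-$. Notation: $\binom{m-\alpha}{m}:=\frac{(1-\alpha)(2-\alpha)\cdots(m-\alpha)}{m!}$ for $m\ge1$, $\binom{-\alpha}{0}:=1$, and $\binom{N}{x_1,\dots,x_n}=\frac{N!}{x_1!\cdots x_n!}$ is the multinomial coefficient. $h$ is an un-normalised weight, not itself a probability distribution. *)

theory Defs
  imports "HOL-Probability.Probability"
begin

subsection \<open>The potentials and the partition function\<close>

definition Omega :: "(real ^ 'n) set" where
  "Omega = {\<theta>. (\<Sum>i\<in>UNIV. exp (\<theta> $ i)) < 1}"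

definition Psi_plus :: "real ^ 'n \<Rightarrow> real" where
  "Psi_plus \<theta> = ln (1 + (\<Sum>i\<in>UNIV. exp (\<theta> $ i)))"

definition Psi_minus :: "real ^ 'n \<Rightarrow> real" where
  "Psi_minus \<theta> = - ln (1 - (\<Sum>i\<in>UNIV. exp (\<theta> $ i)))"

definition Psi :: "real \<Rightarrow> real ^ 'n \<Rightarrow> real" where
  "Psi \<alpha> \<theta> = \<alpha> * Psi_plus \<theta> + (1 - \<alpha>) * Psi_minus \<theta>"

definition partition_fun :: "real \<Rightarrow> real ^ 'n \<Rightarrow> real" where
  "partition_fun \<alpha> \<theta> = exp (Psi \<alpha> \<theta>)"


subsection \<open>Weights on the lattice of nonnegative integer vectors\<close>

definition shifted_binom :: "real \<Rightarrow> nat \<Rightarrow> real" where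
  "shifted_binom \<alpha> m = (\<Prod>k=1..m. real k - \<alpha>) / fact m"

definition multinomial_coeff :: "nat ^ 'n \<Rightarrow> real" where
  "multinomial_coeff x = fact (\<Sum>i\<in>UNIV. x $ i) / (\<Prod>i\<in>UNIV. fact (x $ i))"

definition base_weight :: "real \<Rightarrow> nat ^ 'n \<Rightarrow> real" where
  "base_weight \<alpha> x =
     (let N = (\<Sum>i\<in>UNIV. x $ i); m = N div 2 in shifted_binom \<alpha> m * multinomial_coeff x)"

definition pairing :: "real ^ 'n \<Rightarrow> nat ^ 'n \<Rightarrow> real" where
  "pairing \<theta> x = (\<Sum>i\<in>UNIV. \<theta> $ i * real (x $ i))"

text \<open>
  Nonnegativity of the weights is deliberately not part of this predicate, so that the
  uniqueness of the weights is asserted among all signed (absolutely summable) ones.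
\<close>
definition generates_partition_fun :: "real \<Rightarrow> (nat ^ 'n \<Rightarrow> real) \<Rightarrow> bool" where
  "generates_partition_fun \<alpha> h \<longleftrightarrow>
     (\<forall>\<theta>\<in>Omega. ((\<lambda>x. h x * exp (pairing \<theta> x)) has_sum partition_fun \<alpha> \<theta>) UNIV)"


subsection \<open>The three-step sampling construction\<close>

definition nb_law :: "real \<Rightarrow> real \<Rightarrow> nat pmf" where
  "nb_law \<alpha> s = embed_pmf (\<lambda>m. shifted_binom \<alpha> m * s ^ (2 * m) /
                                (\<Sum>k. shifted_binom \<alpha> k * s ^ (2 * k)))"

definition multinomial_pmf :: "nat \<Rightarrow> ('n \<Rightarrow> real) \<Rightarrow> (nat ^ 'n) pmf" where
  "multinomial_pmf N p = embed_pmf (\<lambda>x.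
     if (\<Sum>i\<in>UNIV. x $ i) = N then multinomial_coeff x * (\<Prod>i\<in>UNIV. p i ^ (x $ i)) else 0)"

definition sample_law :: "real \<Rightarrow> real ^ 'n \<Rightarrow> (nat ^ 'n) pmf" where
  "sample_law \<alpha> \<theta> =
     (let u = (\<lambda>i. exp (\<theta> $ i)); s = (\<Sum>i\<in>UNIV. u i) in
      do {
        m \<leftarrow> nb_law \<alpha> s;
        b \<leftarrow> bernoulli_pmf (s / (1 + s));
        multinomial_pmf (2 * m + of_bool b) (\<lambda>i. u i / s)
      })"


subsection \<open>The laws used in the construction are well defined\<close>

text \<open>
  Outside the range of genuine mass functions \<^const>\<open>embed_pmf\<close> is unspecified;
  the lemmas \<open>pmf_nb_law\<close> and \<open>pmf_multinomial\<close> below show that this does not happen here.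
\<close>

lemma shifted_binom_0 [simp]: "shifted_binom \<alpha> 0 = 1"
  by (simp add: shifted_binom_def)

lemma shifted_binom_nonneg: "\<alpha> \<le> 1 \<Longrightarrow> 0 \<le> shifted_binom \<alpha> m"
  unfolding shifted_binom_def by (intro divide_nonneg_nonneg prod_nonneg) auto

lemma shifted_binom_eq_gchoose: "shifted_binom \<alpha> m = (real m - \<alpha>) gchoose m"
proof -
  have "(\<Prod>k=1..m. real k - \<alpha>) = (\<Prod>i=0..<m. real m - \<alpha> - real i)"
    by (rule prod.reindex_bij_witness[of _ "\<lambda>i. m - i" "\<lambda>k. m - k"]) (auto simp: of_nat_diff)
  then show ?thesis by (simp add: shifted_binom_def gbinomial_prod_rev)
qed

lemma shifted_binom_sums:
  assumes "\<bar>s\<bar> < 1"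
  shows "(\<lambda>m. shifted_binom \<alpha> m * s ^ (2 * m)) sums (1 - s\<^sup>2) powr (\<alpha> - 1)"
proof -
  have "\<bar>- (s\<^sup>2)\<bar> < 1" using assms by (simp add: abs_square_less_1)
  from gen_binomial_real[OF this, of "\<alpha> - 1"]
  have "(\<lambda>m. ((\<alpha> - 1) gchoose m) * (- (s\<^sup>2)) ^ m) sums (1 - s\<^sup>2) powr (\<alpha> - 1)" by simp
  moreover have "((\<alpha> - 1) gchoose m) * (- (s\<^sup>2)) ^ m = shifted_binom \<alpha> m * s ^ (2 * m)" for m
  proof -
    have "((\<alpha> - 1) gchoose m) = (- 1) ^ m * shifted_binom \<alpha> m"
      by (subst gbinomial_negated_upper) (simp add: shifted_binom_eq_gchoose algebra_simps)
    moreover have "(- (s\<^sup>2)) ^ m = (- 1) ^ m * s ^ (2 * m)"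
      by (subst power_minus) (simp add: power_mult)
    moreover have "(- 1 :: real) ^ m * (- 1) ^ m = 1"
      by (simp flip: power_mult_distrib)
    ultimately show ?thesis by (simp add: algebra_simps)
  qed
  ultimately show ?thesis by simp
qed

lemma pmf_nb_law:
  assumes "\<alpha> \<le> 1" "\<bar>s\<bar> < 1"
  shows "pmf (nb_law \<alpha> s) m =
           shifted_binom \<alpha> m * s ^ (2 * m) / (\<Sum>k. shifted_binom \<alpha> k * s ^ (2 * k))"
proof -
  define w where "w = (\<lambda>m. shifted_binom \<alpha> m * s ^ (2 * m))"
  define Z where "Z = (1 - s\<^sup>2) powr (\<alpha> - 1)"
  have sums: "w sums Z"
    unfolding w_def Z_def by (rule shifted_binom_sums) fact
  have "s\<^sup>2 < 1" using assms by (simp add: abs_square_less_1)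
  then have Z: "Z > 0" by (simp add: Z_def)
  have w: "0 \<le> w m" for m
    using assms shifted_binom_nonneg[of \<alpha> m] by (simp add: w_def power_mult)
  have Zsum: "suminf w = Z" using sums by (simp add: sums_iff)
  have "(\<lambda>m. w m / Z) sums (Z / Z)" by (intro sums_divide sums)
  then have one: "(\<lambda>m. w m / Z) sums 1" using Z by simp
  have "(\<integral>\<^sup>+m. ennreal (w m / Z) \<partial>count_space UNIV) = (\<Sum>m. ennreal (w m / Z))"
    by (rule nn_integral_count_space_nat)
  also have "\<dots> = 1"
    using one w Z by (subst suminf_ennreal2) (auto simp: sums_iff)
  finally have int: "(\<integral>\<^sup>+m. ennreal (w m / Z) \<partial>count_space UNIV) = 1" .
  have "pmf (embed_pmf (\<lambda>m. w m / Z)) m = w m / Z"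
    using w Z int by (intro pmf_embed_pmf) auto
  then show ?thesis
    using Zsum by (simp add: nb_law_def w_def)
qed

lemma multinomial_theorem_aux:
  fixes p :: "'a \<Rightarrow> real"
  assumes "finite A"
  shows "finite {x :: 'a \<Rightarrow> nat. (\<forall>i. i \<notin> A \<longrightarrow> x i = 0) \<and> sum x A = N}
       \<and> (\<Sum>x | (\<forall>i. i \<notin> A \<longrightarrow> x i = 0) \<and> sum x A = N. \<Prod>i\<in>A. p i ^ x i / fact (x i))
           = sum p A ^ N / fact N"
  using assms
proof (induction A arbitrary: N rule: finite_induct)
  case empty
  have "{x :: 'a \<Rightarrow> nat. (\<forall>i. x i = 0) \<and> N = 0} = (if N = 0 then {\<lambda>_. 0} else {})"
    by auto
  then show ?case by (cases "N = 0") auto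
next
  case (insert a A)
  define S where "S B M = {x :: 'a \<Rightarrow> nat. (\<forall>i. i \<notin> B \<longrightarrow> x i = 0) \<and> sum x B = M}" for B M
  define t where "t B x = (\<Prod>i\<in>B. p i ^ x i / fact (x i))" for B and x :: "'a \<Rightarrow> nat"
  have finS: "finite (S A M)" and sumS: "sum (t A) (S A M) = sum p A ^ M / fact M" for M
    using insert.IH[of M] by (auto simp: S_def t_def)
  define f where "f = (\<lambda>(k, x :: 'a \<Rightarrow> nat). x(a := k))"
  have sum_upd: "sum (x(a := k)) A = sum x A" for x :: "'a \<Rightarrow> nat" and k
    using insert.hyps by (intro sum.cong) auto
  have sum_if: "(\<Sum>i\<in>A. if i = a then k else x i) = sum x A" for x :: "'a \<Rightarrow> nat" and k
    using insert.hyps by (intro sum.cong) auto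
  have bij: "bij_betw f (SIGMA k:{..N}. S A (N - k)) (S (insert a A) N)"
  proof (rule bij_betwI[where g = "\<lambda>x. (x a, x(a := 0))"])
    show "f \<in> (SIGMA k:{..N}. S A (N - k)) \<rightarrow> S (insert a A) N"
      using insert.hyps by (auto simp: f_def S_def sum_upd sum_if)
    show "(\<lambda>x. (x a, x(a := 0))) \<in> S (insert a A) N \<rightarrow> (SIGMA k:{..N}. S A (N - k))"
      using insert.hyps by (auto simp: S_def sum_upd sum_if)
    show "(f x a, (f x)(a := 0)) = x" if "x \<in> (SIGMA k:{..N}. S A (N - k))" for x
      using that insert.hyps by (auto simp: f_def S_def fun_eq_iff split: prod.splits)
    show "f (x a, x(a := 0)) = x" if "x \<in> S (insert a A) N" for x
      by (auto simp: f_def)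
  qed
  have finI: "finite (S (insert a A) N)"
    using bij_betw_finite[OF bij] finS by auto
  have t_upd: "t (insert a A) (x(a := k)) = p a ^ k / fact k * t A x" for x k
  proof -
    have "t A (x(a := k)) = t A x"
      unfolding t_def using insert.hyps by (intro prod.cong) auto
    then show ?thesis using insert.hyps by (simp add: t_def)
  qed
  have "sum (t (insert a A)) (S (insert a A) N) =
          (\<Sum>y\<in>(SIGMA k:{..N}. S A (N - k)). t (insert a A) (f y))"
    by (rule sum.reindex_bij_betw[OF bij, symmetric])
  also have "\<dots> = (\<Sum>(k, x)\<in>(SIGMA k:{..N}. S A (N - k)). p a ^ k / fact k * t A x)"
    by (intro sum.cong) (auto simp: f_def t_upd)
  also have "\<dots> = (\<Sum>k\<le>N. \<Sum>x\<in>S A (N - k). p a ^ k / fact k * t A x)"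
    by (rule sum.Sigma[symmetric]) (auto simp: finS)
  also have "\<dots> = (\<Sum>k\<le>N. p a ^ k / fact k * (sum p A ^ (N - k) / fact (N - k)))"
    by (simp only: sum_distrib_left[symmetric] sumS)
  also have "\<dots> = (\<Sum>k\<le>N. real (N choose k) * p a ^ k * sum p A ^ (N - k)) / fact N"
    unfolding sum_divide_distrib by (intro sum.cong) (auto simp: binomial_fact)
  also have "\<dots> = (p a + sum p A) ^ N / fact N"
    by (subst binomial_ring) simp
  also have "p a + sum p A = sum p (insert a A)"
    using insert.hyps by simp
  finally show ?case using finI by (simp add: S_def t_def)
qed

lemma pmf_multinomial:
  fixes p :: "'n :: finite \<Rightarrow> real"
  assumes nonneg: "\<And>i. 0 \<le> p i" and total: "(\<Sum>i\<in>UNIV. p i) = 1"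
  shows "pmf (multinomial_pmf N p) x =
           (if (\<Sum>i\<in>UNIV. x $ i) = N
            then multinomial_coeff x * (\<Prod>i\<in>UNIV. p i ^ (x $ i)) else 0)"
proof -
  define f where "f x = (if (\<Sum>i\<in>UNIV. x $ i) = N
      then multinomial_coeff x * (\<Prod>i\<in>UNIV. p i ^ (x $ i)) else 0)" for x :: "nat ^ 'n"
  define T where "T = {y :: 'n \<Rightarrow> nat. sum y UNIV = N}"
  have T: "finite T" "(\<Sum>y\<in>T. \<Prod>i\<in>UNIV. p i ^ y i / fact (y i)) = 1 / fact N"
    using multinomial_theorem_aux[of UNIV N p] total by (auto simp: T_def)
  have f0: "0 \<le> f x" for x
    using nonneg by (auto simp: f_def multinomial_coeff_def intro!: mult_nonneg_nonneg
      divide_nonneg_nonneg prod_nonneg)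
  have bij: "bij_betw vec_lambda T {x :: nat ^ 'n. (\<Sum>i\<in>UNIV. x $ i) = N}"
    by (rule bij_betwI[where g = vec_nth]) (auto simp: T_def)
  have fin: "finite {x :: nat ^ 'n. (\<Sum>i\<in>UNIV. x $ i) = N}"
    using bij_betw_finite[OF bij] T(1) by simp
  have "sum f {x. (\<Sum>i\<in>UNIV. x $ i) = N} = (\<Sum>y\<in>T. f (vec_lambda y))"
    by (rule sum.reindex_bij_betw[OF bij, symmetric])
  also have "\<dots> = (\<Sum>y\<in>T. fact N * (\<Prod>i\<in>UNIV. p i ^ y i / fact (y i)))"
    by (intro sum.cong) (auto simp: f_def T_def multinomial_coeff_def prod_dividef)
  also have "\<dots> = 1"
    unfolding sum_distrib_left[symmetric] T(2) by simp
  finally have tot: "sum f {x. (\<Sum>i\<in>UNIV. x $ i) = N} = 1" .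
  have "(\<integral>\<^sup>+x. ennreal (f x) \<partial>count_space UNIV) =
          (\<Sum>x | (\<Sum>i\<in>UNIV. x $ i) = N. ennreal (f x))"
    by (rule nn_integral_count_space'[OF fin]) (auto simp: f_def)
  also have "\<dots> = 1"
    using f0 tot by (simp add: sum_ennreal)
  finally have int: "(\<integral>\<^sup>+x. ennreal (f x) \<partial>count_space UNIV) = 1" .
  have "pmf (embed_pmf f) x = f x"
    using f0 int by (intro pmf_embed_pmf) auto
  moreover have "multinomial_pmf N p = embed_pmf f"
    unfolding multinomial_pmf_def f_def ..
  ultimately show ?thesis by (simp add: f_def)
qed

end

theory Submission
  imports Defs "HOL-Real_Asymp.Real_Asymp"
begin

text \<open>
  Existence of the generating weights comes for free from the sampling law: the event
  \<open>X = x\<close> forces \<open>M = N div 2\<close> and \<open>B = N mod 2\<close>, so its probability is a single product, and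
  these probabilities sum to \<open>1\<close>.  For uniqueness, let \<open>g\<close> be the difference of two systems of
  weights and choose \<open>w\<close> with positive entries such that \<open>x \<mapsto> w \<cdot> x\<close> is injective on
  lattice points; it exists because countably many hyperplanes do not cover the positive orthant.  Along the ray \<open>\<theta> = - \<tau> w\<close> with \<open>\<tau> \<rightarrow> \<infinity>\<close> the sum of \<open>g(x) exp (\<theta> \<cdot> x)\<close> is
  dominated by the point of the support of \<open>g\<close> at which \<open>w \<cdot> x\<close> is least, so the sum cannot vanish
  identically unless \<open>g = 0\<close>.
\<close>

section \<open>Closed form of the partition function\<close>

lemma partition_fun_closed_form:
  fixes \<theta> :: "real ^ 'n"
  defines "s \<equiv> (\<Sum>i\<in>UNIV. exp (\<theta> $ i))"
  assumes "\<theta> \<in> Omega"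
  shows "partition_fun \<alpha> \<theta> = (1 + s) powr \<alpha> * (1 - s) powr (\<alpha> - 1)"
    and "(1 + s) powr \<alpha> * (1 - s) powr (\<alpha> - 1) = (1 + s) * (1 - s\<^sup>2) powr (\<alpha> - 1)"
proof -
  have s: "0 \<le> s" "s < 1"
    using assms by (auto simp: Omega_def intro!: sum_nonneg)
  show "partition_fun \<alpha> \<theta> = (1 + s) powr \<alpha> * (1 - s) powr (\<alpha> - 1)"
    using s unfolding partition_fun_def Psi_def Psi_plus_def Psi_minus_def s_def[symmetric]
    by (simp add: powr_def exp_add[symmetric] algebra_simps)
  \<comment> \<open>This form separates two normalising constants: \<open>1 + s\<close> belongs to
    the Bernoulli draw and the power of \<open>1 - s\<^sup>2\<close> to
    \<open>nb_law\<close>.\<close>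
  have "1 - s\<^sup>2 = (1 + s) * (1 - s)"
    by (simp add: power2_eq_square algebra_simps)
  then have "(1 - s\<^sup>2) powr (\<alpha> - 1) = (1 + s) powr (\<alpha> - 1) * (1 - s) powr (\<alpha> - 1)"
    using s by (simp add: powr_mult)
  moreover have "(1 + s) powr \<alpha> = (1 + s) * (1 + s) powr (\<alpha> - 1)"
    using s by (simp add: powr_mult_base)
  ultimately show "(1 + s) powr \<alpha> * (1 - s) powr (\<alpha> - 1) = (1 + s) * (1 - s\<^sup>2) powr (\<alpha> - 1)"
    by simp
qed

section \<open>Law of the sample and existence of the weights\<close>

lemma base_weight_nonneg: "\<alpha> \<le> 1 \<Longrightarrow> 0 \<le> base_weight \<alpha> x"
  by (auto simp: base_weight_def Let_def multinomial_coeff_def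
      intro!: mult_nonneg_nonneg shifted_binom_nonneg divide_nonneg_nonneg prod_nonneg)

lemma exp_pairing: "exp (pairing \<theta> x) = (\<Prod>i\<in>UNIV. exp (\<theta> $ i) ^ (x $ i))"
  by (simp add: pairing_def exp_sum exp_of_nat2_mult)

text \<open>The powers of \<open>s\<close> cancel: the first two draws contribute \<open>s\<close>
  to the power 2M + B = N, and the multinomial with cell probabilities
  \<open>exp (\<theta> $ i) / s\<close> contributes its inverse. The remaining normalisers multiply
  to the partition function.\<close>

lemma pmf_sample_law:
  fixes \<theta> :: "real ^ 'n"
  assumes "\<alpha> \<le> 1" and \<theta>: "\<theta> \<in> Omega"
  shows "pmf (sample_law \<alpha> \<theta>) x = base_weight \<alpha> x * exp (pairing \<theta> x) / partition_fun \<alpha> \<theta>"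
proof -
  define s where "s = (\<Sum>i\<in>UNIV. exp (\<theta> $ i))"
  define p where "p i = exp (\<theta> $ i) / s" for i
  define N where "N = (\<Sum>i\<in>UNIV. x $ i)"
  define b where "b = odd N"
  \<comment> \<open>The index type is nonempty, so \<open>s\<close> is strictly positive and the
    division by it yields a genuine probability vector.\<close>
  have s: "0 < s" "s < 1"
    using \<theta> by (auto simp: s_def Omega_def intro!: sum_pos)
  have p: "0 \<le> p i" "sum p UNIV = 1" for i
    using s by (auto simp: p_def sum_divide_distrib[symmetric] s_def[symmetric])
  have N: "2 * (N div 2) + of_bool b = N"
    by (simp add: b_def)
  have N_iff: "N = 2 * m + of_bool c \<longleftrightarrow> m = N div 2 \<and> c = b" for m c
    by (cases c) (auto simp: b_def)
  have mult: "pmf (multinomial_pmf k p) x =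
      (if N = k then multinomial_coeff x * exp (pairing \<theta> x) / s ^ N else 0)" for k
    by (subst pmf_multinomial[OF p])
      (auto simp: N_def p_def power_divide prod_dividef exp_pairing power_sum)
  have inner: "pmf (bernoulli_pmf (s / (1 + s)) \<bind> (\<lambda>c. multinomial_pmf (2 * m + of_bool c) p)) x =
      (if m = N div 2 then pmf (multinomial_pmf N p) x * pmf (bernoulli_pmf (s / (1 + s))) b else 0)"
    for m
    unfolding pmf_bind
    by (subst integral_measure_pmf_real[where A = "{b}"])
      (auto simp: mult N_iff split: if_splits)
  have "pmf (sample_law \<alpha> \<theta>) x =
      pmf (multinomial_pmf N p) x * pmf (bernoulli_pmf (s / (1 + s))) b * pmf (nb_law \<alpha> s) (N div 2)"
    unfolding sample_law_def Let_def s_def[symmetric] p_def[symmetric]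
    by (subst pmf_bind, subst integral_measure_pmf_real[where A = "{N div 2}"])
      (auto simp: inner split: if_splits)
  also have "pmf (bernoulli_pmf (s / (1 + s))) b = s ^ of_bool b / (1 + s)"
    using s by (cases b) (auto simp: field_simps)
  also have "pmf (nb_law \<alpha> s) (N div 2) =
      shifted_binom \<alpha> (N div 2) * s ^ (2 * (N div 2)) / (1 - s\<^sup>2) powr (\<alpha> - 1)"
    using assms s shifted_binom_sums[of s \<alpha>] by (subst pmf_nb_law) (auto simp: sums_iff)
  also have "pmf (multinomial_pmf N p) x * (s ^ of_bool b / (1 + s)) * \<dots> =
      pmf (multinomial_pmf N p) x * s ^ (2 * (N div 2) + of_bool b) * shifted_binom \<alpha> (N div 2) /
        ((1 + s) * (1 - s\<^sup>2) powr (\<alpha> - 1))"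
    by (simp add: power_add)
  also have "\<dots> = base_weight \<alpha> x * exp (pairing \<theta> x) / partition_fun \<alpha> \<theta>"
    unfolding N using s partition_fun_closed_form[OF \<theta>, of \<alpha>]
    by (simp add: mult s_def[symmetric] base_weight_def Let_def N_def[symmetric])
  finally show ?thesis .
qed

text \<open>Carries the total mass over from \<open>infsetsum\<close> to the notion of sum used in
  \<open>generates_partition_fun\<close>.\<close>

lemma has_sum_pmf: "(pmf p has_sum 1) UNIV"
proof -
  have "Infinite_Set_Sum.abs_summable_on (pmf p) UNIV"
    by (rule pmf_abs_summable)
  then have "pmf p summable_on UNIV" "infsum (pmf p) UNIV = 1"
    using infsetsum_infsum[of "pmf p" UNIV] infsetsum_pmf_eq_1[of p UNIV]
    by (auto simp: abs_summable_equivalent[symmetric] intro: abs_summable_summable)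
  then show ?thesis
    by (metis has_sum_infsum)
qed

lemma generates_partition_fun_base_weight:
  assumes "\<alpha> \<le> 1"
  shows "generates_partition_fun \<alpha> (base_weight \<alpha> :: nat ^ 'n \<Rightarrow> real)"
  unfolding generates_partition_fun_def
proof
  fix \<theta> :: "real ^ 'n" assume "\<theta> \<in> Omega"
  have "partition_fun \<alpha> \<theta> * pmf (sample_law \<alpha> \<theta>) x = base_weight \<alpha> x * exp (pairing \<theta> x)" for x
    using pmf_sample_law[OF assms \<open>\<theta> \<in> Omega\<close>] by (simp add: partition_fun_def)
  with has_sum_cmult_right[OF has_sum_pmf, of "partition_fun \<alpha> \<theta>" "sample_law \<alpha> \<theta>"]
  show "((\<lambda>x. base_weight \<alpha> x * exp (pairing \<theta> x)) has_sum partition_fun \<alpha> \<theta>) UNIV"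
    by simp
qed

section \<open>Uniqueness of the weights\<close>

lemma exists_positive_injective_pairing:
  obtains w :: "real ^ 'n" where "\<And>i. 0 < w $ i" and "inj (pairing w)"
proof -
  define v :: "nat ^ 'n \<Rightarrow> real ^ 'n" where "v x = (\<chi> i. real (x $ i))" for x
  have pairing: "pairing w x = v x \<bullet> w" for w x
    by (simp add: pairing_def v_def inner_vec_def mult.commute)
  have "v x \<noteq> v y" if "x \<noteq> y" for x y
    using that by (auto simp: v_def vec_eq_iff)
  then have "negligible {w. (v x - v y) \<bullet> w = 0}" if "x \<noteq> y" for x y
    using that by (intro negligible_hyperplane) auto
  \<comment> \<open>There are countably many pairs of lattice points, so the directions in which
    some pair collides form a Lebesgue null set. The positive orthant is open and nonempty, hence
    not contained in it.\<close>
  then have neg: "negligible (\<Union>((\<lambda>(x, y). {w. (v x - v y) \<bullet> w = 0}) ` {(x, y). x \<noteq> y}))"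
    by (intro negligible_countable_Union) auto
  have pos: "\<not> negligible {w :: real ^ 'n. \<forall>i. 0 < w $ i}"
  proof (rule open_not_negligible)
    have "{w :: real ^ 'n. \<forall>i. 0 < w $ i} = (\<Inter>i. {w. 0 < w $ i})"
      by auto
    then show "open {w :: real ^ 'n. \<forall>i. 0 < w $ i}"
      by (auto intro!: open_Collect_less continuous_intros)
    have "(\<chi> i. 1) \<in> {w :: real ^ 'n. \<forall>i. 0 < w $ i}"
      by simp
    then show "{w :: real ^ 'n. \<forall>i. 0 < w $ i} \<noteq> {}"
      by blast
  qed
  have "\<not> {w. \<forall>i. 0 < w $ i} \<subseteq> \<Union>((\<lambda>(x, y). {w. (v x - v y) \<bullet> w = 0}) ` {(x, y). x \<noteq> y})"
    by (rule contrapos_nn[OF pos]) (rule negligible_subset[OF neg])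
  then obtain w where "\<forall>i. 0 < w $ i" and w: "\<forall>x y. x \<noteq> y \<longrightarrow> (v x - v y) \<bullet> w \<noteq> 0"
    unfolding subset_iff by auto
  then show ?thesis
    using that[of w] by (auto simp: inj_def pairing inner_diff_left)
qed

text \<open>Positive entries of \<open>w\<close> bound each coordinate by \<open>c / w $ i\<close>.
  This discreteness is what lets a least exponent exist and be isolated.\<close>

lemma finite_pairing_le:
  fixes w :: "real ^ 'n"
  assumes w: "\<And>i. 0 < w $ i"
  shows "finite {x. pairing w x \<le> c}"
proof (rule finite_subset)
  define K where "K i = {..nat \<lfloor>c / w $ i\<rfloor>}" for i
  show "{x. pairing w x \<le> c} \<subseteq> vec_lambda ` (PiE UNIV K)"
  proof
    fix x assume "x \<in> {x. pairing w x \<le> c}"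
    moreover have "w $ i * real (x $ i) \<le> pairing w x" for i
      unfolding pairing_def using w by (intro member_le_sum) (auto simp: less_imp_le)
    ultimately have "w $ i * real (x $ i) \<le> c" for i
      by (metis mem_Collect_eq order_trans)
    then have "x $ i \<in> K i" for i
      using w[of i] by (simp add: K_def le_nat_floor field_simps)
    then show "x \<in> vec_lambda ` (PiE UNIV K)"
      by (intro image_eqI[of _ _ "vec_nth x"]) auto
  qed
  show "finite (vec_lambda ` (PiE UNIV K))"
    by (intro finite_imageI finite_PiE) (auto simp: K_def)
qed

text \<open>If \<open>g\<close> is nonzero, let \<open>a\<close> be the point of its support with
  least \<open>E\<close>. After division by \<open>exp (- \<tau> * E a)\<close> the other terms
  together are at most a constant times \<open>exp (- \<tau> * \<delta>)\<close> for a gap \<delta>,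
  so they cannot cancel \<open>g a\<close> for large \<tau>.\<close>

lemma dirichlet_series_unique:
  fixes g E :: "'a \<Rightarrow> real"
  assumes fin: "\<And>c. finite {x. E x \<le> c}" and inj: "inj E"
    and zero: "\<And>\<tau>. \<tau> \<ge> \<tau>\<^sub>0 \<Longrightarrow> ((\<lambda>x. g x * exp (- \<tau> * E x)) has_sum 0) UNIV"
  shows "g y = 0"
proof (rule ccontr)
  assume y: "g y \<noteq> 0"
  \<comment> \<open>Cutting at \<open>E y\<close> leaves a finite set; support points outside it
    have larger \<open>E\<close>, so a minimiser on \<open>S\<close> is one on the whole
    support.\<close>
  define S where "S = {x. g x \<noteq> 0 \<and> E x \<le> E y}"
  have "finite S" "y \<in> S"
    using y by (auto simp: S_def intro: finite_subset[OF _ fin[of "E y"]])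
  then obtain a where a: "a \<in> S" "\<And>x. x \<in> S \<Longrightarrow> E a \<le> E x"
    by (metis arg_min_if_finite(1) arg_min_least empty_iff)
  have "E a < E x" if "g x \<noteq> 0" "x \<noteq> a" for x
  proof -
    have "E a \<le> E x"
      using a that by (cases "E x \<le> E y") (auto simp: S_def)
    with that inj show ?thesis
      by (auto simp: inj_def order.strict_iff_order)
  qed
  \<comment> \<open>Support points beyond \<open>E a + 1\<close> are separated from \<open>a\<close>
    by more than 1, so only the finitely many in \<open>T\<close> can shrink the gap below
    1.\<close>
  moreover define T where "T = {x. g x \<noteq> 0 \<and> x \<noteq> a \<and> E x \<le> E a + 1}"
  moreover have "finite T"
    by (rule finite_subset[OF _ fin[of "E a + 1"]]) (auto simp: T_def)
  ultimately obtain \<delta> where "0 < \<delta>" and gap: "\<And>x. g x \<noteq> 0 \<Longrightarrow> x \<noteq> a \<Longrightarrow> E a + \<delta> \<le> E x"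
  proof -
    assume lt: "\<And>x. g x \<noteq> 0 \<Longrightarrow> x \<noteq> a \<Longrightarrow> E a < E x"
    define \<delta> where "\<delta> = Min (insert 1 ((\<lambda>x. E x - E a) ` T))"
    have "0 < \<delta>"
      using \<open>finite T\<close> lt by (auto simp: \<delta>_def T_def)
    moreover have "E a + \<delta> \<le> E x" if "g x \<noteq> 0" "x \<noteq> a" for x
    proof (cases "E x \<le> E a + 1")
      case True
      then have "\<delta> \<le> E x - E a"
        using that \<open>finite T\<close> unfolding \<delta>_def by (intro Min_le) (auto simp: T_def)
      then show ?thesis by simp
    next
      case False
      moreover have "\<delta> \<le> 1"
        using \<open>finite T\<close> unfolding \<delta>_def by (intro Min_le) auto
      ultimately show ?thesis by simp
    qed
    ultimately show thesis by (rule that)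
  qed
  \<comment> \<open>Real summability is absolute, so the single parameter
    \<open>\<tau>\<^sub>0\<close> provides a constant \<open>C\<close> that serves all larger
    \<tau>.\<close>
  have "(\<lambda>x. norm (g x * exp (- \<tau>\<^sub>0 * E x))) summable_on UNIV"
    using zero[of \<tau>\<^sub>0] by (metis has_sum_imp_summable order_refl summable_on_iff_abs_summable_on_real)
  then obtain C where C: "((\<lambda>x. \<bar>g x\<bar> * exp (- \<tau>\<^sub>0 * E x)) has_sum C) UNIV"
    by (auto simp: summable_on_def abs_mult)
  have bound: "\<bar>g a\<bar> \<le> C * exp (\<tau>\<^sub>0 * (E a + \<delta>)) * exp (- \<tau> * \<delta>)" if \<tau>: "\<tau> \<ge> \<tau>\<^sub>0" for \<tau>
  proof -
    define f where "f = (\<lambda>x. g x * exp (- \<tau> * E x))"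
    have f: "(f has_sum 0) (insert a (- {a}))"
      using zero[OF \<tau>] by (simp add: f_def insert_absorb Compl_insert)
    then have "f summable_on (- {a})"
      by (rule summable_on_subset_banach[OF has_sum_imp_summable]) auto
    then obtain R where R: "(f has_sum R) (- {a})"
      by (auto simp: summable_on_def)
    \<comment> \<open>Setting the term at \<open>a\<close> to 0 extends the tail to
      \<open>UNIV\<close>, where it is compared termwise with the series for
      \<open>C\<close>.\<close>
    have "((\<lambda>x. if x = a then 0 else f x) has_sum R) UNIV"
      by (rule iffD1[OF has_sum_cong_neutral R]) auto
    then have "norm R \<le> C * exp ((\<tau>\<^sub>0 - \<tau>) * (E a + \<delta>))"
    proof (rule norm_infsum_le[OF _ has_sum_cmult_left[OF C]])
      fix x
      show "norm (if x = a then 0 else f x) \<le>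
          \<bar>g x\<bar> * exp (- \<tau>\<^sub>0 * E x) * exp ((\<tau>\<^sub>0 - \<tau>) * (E a + \<delta>))"
      proof (cases "x = a \<or> g x = 0")
        case False
        then have "(\<tau> - \<tau>\<^sub>0) * (E a + \<delta>) \<le> (\<tau> - \<tau>\<^sub>0) * E x"
          using gap \<tau> by (intro mult_left_mono) auto
        then have "exp (- \<tau> * E x) \<le> exp (- \<tau>\<^sub>0 * E x) * exp ((\<tau>\<^sub>0 - \<tau>) * (E a + \<delta>))"
          unfolding exp_add[symmetric] exp_le_cancel_iff by (simp add: algebra_simps)
        then show ?thesis
          using False by (simp add: f_def abs_mult mult_left_mono mult.assoc)
      qed (auto simp: f_def)
    qed
    moreover have "R = - f a"
      using has_sum_unique[OF has_sum_insert[OF _ R] f] by simp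
    ultimately have "\<bar>g a\<bar> * exp (- \<tau> * E a) \<le> C * exp ((\<tau>\<^sub>0 - \<tau>) * (E a + \<delta>))"
      by (simp add: f_def abs_mult)
    also have "\<dots> = C * exp (\<tau>\<^sub>0 * (E a + \<delta>)) * exp (- \<tau> * \<delta>) * exp (- \<tau> * E a)"
      by (simp add: mult.assoc exp_add[symmetric] algebra_simps)
    finally show ?thesis by simp
  qed
  \<comment> \<open>The left side of \<open>bound\<close> is independent of \<tau>, so the limit
    forces \<open>g a = 0\<close>, against the choice of \<open>a\<close> in the support.\<close>
  have "((\<lambda>\<tau>. C * exp (\<tau>\<^sub>0 * (E a + \<delta>)) * exp (- \<tau> * \<delta>)) \<longlongrightarrow> 0) at_top"
    using \<open>0 < \<delta>\<close> by real_asymp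
  then have "\<bar>g a\<bar> \<le> 0"
    by (rule tendsto_lowerbound) (use bound in \<open>auto intro: eventually_at_top_linorderI[of \<tau>\<^sub>0]\<close>)
  then show False
    using a by (simp add: S_def)
qed

lemma generates_partition_fun_unique:
  fixes h h' :: "nat ^ 'n \<Rightarrow> real"
  assumes "generates_partition_fun \<alpha> h" and "generates_partition_fun \<alpha> h'"
  shows "h = h'"
proof
  fix y
  obtain w :: "real ^ 'n" where w: "\<And>i. 0 < w $ i" "inj (pairing w)"
    using exists_positive_injective_pairing by metis
  \<comment> \<open>Positivity of \<open>w\<close> brings the ray into \<open>Omega\<close> for all
    large \<tau>; there both expansions hold and their common value cancels.\<close>
  have "((\<lambda>\<tau>. \<Sum>i\<in>UNIV. exp (- \<tau> * w $ i)) \<longlongrightarrow> 0) at_top"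
  proof (rule tendsto_null_sum)
    show "((\<lambda>\<tau>. exp (- \<tau> * w $ i)) \<longlongrightarrow> 0) at_top" for i
      using w(1)[of i] by real_asymp
  qed
  then have "eventually (\<lambda>\<tau>. (\<Sum>i\<in>UNIV. exp (- \<tau> * w $ i)) < 1) at_top"
    by (rule order_tendstoD) simp
  then obtain \<tau>\<^sub>0 where \<tau>\<^sub>0: "\<And>\<tau>. \<tau> \<ge> \<tau>\<^sub>0 \<Longrightarrow> - \<tau> *\<^sub>R w \<in> Omega"
    by (auto simp: eventually_at_top_linorder Omega_def)
  have "h y - h' y = 0"
  proof (rule dirichlet_series_unique[where E = "pairing w" and \<tau>\<^sub>0 = \<tau>\<^sub>0 and g = "\<lambda>x. h x - h' x"])
    fix \<tau> assume "\<tau> \<ge> \<tau>\<^sub>0"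
    have pairing: "pairing (- \<tau> *\<^sub>R w) x = - \<tau> * pairing w x" for x
      by (simp add: pairing_def sum_distrib_left mult.assoc sum_negf)
    have "((\<lambda>x. h x * exp (- \<tau> * pairing w x)) has_sum partition_fun \<alpha> (- \<tau> *\<^sub>R w)) UNIV"
      and "((\<lambda>x. h' x * exp (- \<tau> * pairing w x)) has_sum partition_fun \<alpha> (- \<tau> *\<^sub>R w)) UNIV"
      using assms \<tau>\<^sub>0[OF \<open>\<tau> \<ge> \<tau>\<^sub>0\<close>]
      unfolding generates_partition_fun_def pairing[symmetric] by blast+
    from has_sum_add[OF this(1) has_sum_cmult_right[OF this(2), of "- 1"]]
    show "((\<lambda>x. (h x - h' x) * exp (- \<tau> * pairing w x)) has_sum 0) UNIV"
      by (simp add: left_diff_distrib)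
  qed (use w finite_pairing_le in auto)
  then show "h y = h' y" by simp
qed

theorem theorem6p1:
  fixes \<alpha> :: real
  assumes "0 \<le> \<alpha>" and "\<alpha> \<le> 1"
  shows
    "(\<forall>\<theta>\<in>(Omega :: (real ^ 'n) set).
        let s = (\<Sum>i\<in>UNIV. exp (\<theta> $ i)) in
          partition_fun \<alpha> \<theta> = (1 + s) powr \<alpha> * (1 - s) powr (\<alpha> - 1) \<and>
          (1 + s) powr \<alpha> * (1 - s) powr (\<alpha> - 1) = (1 + s) * (1 - s\<^sup>2) powr (\<alpha> - 1))
     \<and> (\<forall>x :: nat ^ 'n. 0 \<le> base_weight \<alpha> x)
     \<and> (\<forall>h :: nat ^ 'n \<Rightarrow> real. generates_partition_fun \<alpha> h \<longleftrightarrow> h = base_weight \<alpha>)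
     \<and> (\<forall>\<theta>\<in>(Omega :: (real ^ 'n) set). \<forall>x :: nat ^ 'n.
          pmf (sample_law \<alpha> \<theta>) x =
            base_weight \<alpha> x * exp (pairing \<theta> x) / partition_fun \<alpha> \<theta>)"
proof (intro conjI)
  show "\<forall>\<theta>\<in>(Omega :: (real ^ 'n) set).
        let s = (\<Sum>i\<in>UNIV. exp (\<theta> $ i)) in
          partition_fun \<alpha> \<theta> = (1 + s) powr \<alpha> * (1 - s) powr (\<alpha> - 1) \<and>
          (1 + s) powr \<alpha> * (1 - s) powr (\<alpha> - 1) = (1 + s) * (1 - s\<^sup>2) powr (\<alpha> - 1)"
    unfolding Let_def by (intro ballI conjI partition_fun_closed_form)
  show "\<forall>x :: nat ^ 'n. 0 \<le> base_weight \<alpha> x"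
    by (intro allI base_weight_nonneg assms)
  show "\<forall>h :: nat ^ 'n \<Rightarrow> real. generates_partition_fun \<alpha> h \<longleftrightarrow> h = base_weight \<alpha>"
    using generates_partition_fun_base_weight[OF assms(2)] generates_partition_fun_unique by metis
  show "\<forall>\<theta>\<in>(Omega :: (real ^ 'n) set). \<forall>x :: nat ^ 'n.
          pmf (sample_law \<alpha> \<theta>) x =
            base_weight \<alpha> x * exp (pairing \<theta> x) / partition_fun \<alpha> \<theta>"
    by (intro ballI allI pmf_sample_law assms)
qed

end
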